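(* Let $\vec{\omega}\in S^2$ be a unit axis, let $m:[0,\pi]\to(0,\infty)$ be an axisymmetric monitor function (a function of the angle $\theta'$ from $\vec{\omega}$ in physical space), let $\alpha$ be its normalisation constant, and let $F:S^2\to S^2$ be the associated axisymmetric equidistributing map, which sends the point with spherical angles $(\theta,\phi)$ with respect to $\vec{\omega}$ to the point with spherical angles $(\theta'(\theta),\phi)$. Then, at every point of $S^2$ with $\theta\in(0,\pi)$ such that $m$ is continuous at $\theta'=\theta'(\theta)$: (i) The local scaling of the map is given by $$s=\sigma_1\sigma_2=\frac{\alpha}{m(\theta')}.$$ (ii) The local skewness of the map is given by $$Q=\frac12\left(\frac{\alpha}{m(\theta')}\,\frac{\sin^2\theta}{\sin^2\theta'}+\frac{m(\theta')}{\alpha}\,\frac{\sin^2\theta'}{\sin^2\theta}\right).$$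
   Context: $S^2\subset\mathbb{R}^3$ is the unit sphere with its induced Riemannian metric. For a unit vector $\vec{\omega}$, the spherical angles $(\theta,\phi)$ with respect to $\vec{\omega}$ of a point $\vec{\xi}\in S^2$ are defined in an orthonormal frame whose third axis is $\vec{\omega}$ by $\vec{\xi}=(\sin\theta\cos\phi,\sin\theta\sin\phi,\cos\theta)^T$, so $\cos\theta=\vec{\xi}\cdot\vec{\omega}$, $\theta\in[0,\pi]$. Monitor function: $m:[0,\pi]\to(0,\infty)$ is piecewise continuous (finitely many discontinuities), bounded, and bounded away from zero. Its normalisation constant $\alpha$ is defined by $$2\alpha=\int_0^\pi m(t)\sin t\,\mathrm{d}t.$$ Axisymmetric equidistributing map: the function $\theta':[0,\pi]\to[0,\pi]$ is the unique continuous increasing bijection satisfying $$\int_0^{\theta'(\theta)}m(t)\sin t\,\mathrm{d}t=\alpha(1-\cos\theta),\qquad \theta\in[0,\pi].$$ Thus $\theta'(0)=0$, $\theta'(\pi)=\pi$ and, where $m$ is continuous at $\theta'(\theta)$ and $\theta\in(0,\pi)$, $m(\theta')\sin\theta'\,\frac{\mathrm{d}\theta'}{\mathrm{d}\theta}=\alpha\sin\theta$. The map $F:S^2\to S^2$ sends the point with angles $(\theta,\phi)$ to the point with angles $(\theta'(\theta),\phi)$, and fixes $\pm\vec{\omega}$. Local scaling and skewness: at a point where $F$ is differentiable, let $J$ be its Jacobian, regarded as a linear map from the tangent plane of $S^2$ at $\vec{\xi}$ to the tangent plane of $S^2$ at $F(\vec{\xi})$, each with the Euclidean inner product inherited from $\mathbb{R}^3$,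 and let $\sigma_1,\sigma_2$ be its two singular values. The local scaling is $s=\sigma_1\sigma_2$ and the local skewness is $Q=\frac12\left(\frac{\sigma_1}{\sigma_2}+\frac{\sigma_2}{\sigma_1}\right)$. *)

theory Defs
  imports "HOL-Analysis.Analysis"
begin

abbreviation unit_sphere :: "(real ^ 3) set" where
  "unit_sphere \<equiv> sphere 0 1"

text \<open>Orientation is not prescribed; the maps below do not depend on it.\<close>

definition orthonormal_frame :: "real ^ 3 \<Rightarrow> real ^ 3 \<Rightarrow> real ^ 3 \<Rightarrow> bool" where
  "orthonormal_frame e1 e2 e3 \<longleftrightarrow>
     norm e1 = 1 \<and> norm e2 = 1 \<and> norm e3 = 1 \<and>
     e1 \<bullet> e2 = 0 \<and> e1 \<bullet> e3 = 0 \<and> e2 \<bullet> e3 = 0"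

definition spherical_point ::
    "real ^ 3 \<Rightarrow> real ^ 3 \<Rightarrow> real ^ 3 \<Rightarrow> real \<Rightarrow> real \<Rightarrow> real ^ 3" where
  "spherical_point e1 e2 \<omega> \<theta> \<phi> =
     (sin \<theta> * cos \<phi>) *\<^sub>R e1 + (sin \<theta> * sin \<phi>) *\<^sub>R e2 + cos \<theta> *\<^sub>R \<omega>"

text \<open>Only the values of \<open>m\<close> on \<open>[0, pi]\<close> matter. Positivity is part of being
  bounded away from zero.\<close>

definition monitor_function :: "(real \<Rightarrow> real) \<Rightarrow> bool" where
  "monitor_function m \<longleftrightarrow>
     finite {t \<in> {0..pi}. \<not> continuous (at t within {0..pi}) m} \<and>
     (\<exists>c C. 0 < c \<and> (\<forall>t\<in>{0..pi}. c \<le> m t \<and> m t \<le> C))"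

definition normalisation_constant :: "(real \<Rightarrow> real) \<Rightarrow> real" where
  "normalisation_constant m = integral {0..pi} (\<lambda>t. m t * sin t) / 2"

text \<open>For a monitor function, these conditions determine \<open>\<theta>'\<close> uniquely on \<open>[0, pi]\<close>.\<close>

definition equidistributing_angle :: "(real \<Rightarrow> real) \<Rightarrow> (real \<Rightarrow> real) \<Rightarrow> bool" where
  "equidistributing_angle m \<theta>' \<longleftrightarrow>
     continuous_on {0..pi} \<theta>' \<and> strict_mono_on {0..pi} \<theta>' \<and>
     bij_betw \<theta>' {0..pi} {0..pi} \<and>
     (\<forall>\<theta>\<in>{0..pi}. integral {0..\<theta>' \<theta>} (\<lambda>t. m t * sin t)
                  = normalisation_constant m * (1 - cos \<theta>))"

text \<open>The values of \<open>F\<close> off the unit sphere are left unconstrained.\<close>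

definition axisymmetric_map ::
    "real ^ 3 \<Rightarrow> real ^ 3 \<Rightarrow> real ^ 3 \<Rightarrow> (real \<Rightarrow> real) \<Rightarrow> (real ^ 3 \<Rightarrow> real ^ 3) \<Rightarrow> bool" where
  "axisymmetric_map e1 e2 \<omega> \<theta>' F \<longleftrightarrow>
     (\<forall>\<theta>\<in>{0..pi}. \<forall>\<phi>.
        F (spherical_point e1 e2 \<omega> \<theta> \<phi>) = spherical_point e1 e2 \<omega> (\<theta>' \<theta>) \<phi>) \<and>
     F \<omega> = \<omega> \<and> F (- \<omega>) = - \<omega>"

definition tangent_plane :: "real ^ 3 \<Rightarrow> (real ^ 3) set" where
  "tangent_plane \<xi> = {v. v \<bullet> \<xi> = 0}"

definition orthonormal_basis_pair ::
    "'a::real_inner set \<Rightarrow> 'a \<Rightarrow> 'a \<Rightarrow> bool" where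
  "orthonormal_basis_pair U u1 u2 \<longleftrightarrow>
     norm u1 = 1 \<and> norm u2 = 1 \<and> u1 \<bullet> u2 = 0 \<and> span {u1, u2} = U"

text \<open>The two singular values, with multiplicity and in either order, of \<open>J\<close> viewed as a
  linear map between the two-dimensional inner product spaces \<open>U\<close> and \<open>V\<close>: the diagonal
  entries in a singular value decomposition. Only \<open>J\<close> restricted to \<open>U\<close> enters, and the
  condition forces \<open>J\<close> to map \<open>U\<close> into \<open>V\<close>.\<close>

definition singular_value_pair ::
    "('a::real_inner \<Rightarrow> 'b::real_inner) \<Rightarrow> 'a set \<Rightarrow> 'b set \<Rightarrow> real \<Rightarrow> real \<Rightarrow> bool" where
  "singular_value_pair J U V \<sigma>1 \<sigma>2 \<longleftrightarrow>
     0 \<le> \<sigma>1 \<and> 0 \<le> \<sigma>2 \<and>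
     (\<exists>u1 u2 v1 v2. orthonormal_basis_pair U u1 u2 \<and> orthonormal_basis_pair V v1 v2 \<and>
        J u1 = \<sigma>1 *\<^sub>R v1 \<and> J u2 = \<sigma>2 *\<^sub>R v2)"

text \<open>A Frechet derivative within the sphere is a linear map on the whole ambient space, but
  its restriction to the tangent plane is unique: it is the differential of \<open>F\<close> as a map
  between surfaces.\<close>

definition sphere_singular_values ::
    "(real ^ 3 \<Rightarrow> real ^ 3) \<Rightarrow> real ^ 3 \<Rightarrow> real \<Rightarrow> real \<Rightarrow> bool" where
  "sphere_singular_values F \<xi> \<sigma>1 \<sigma>2 \<longleftrightarrow>
     (\<exists>J. (F has_derivative J) (at \<xi> within unit_sphere) \<and>
          singular_value_pair J (tangent_plane \<xi>) (tangent_plane (F \<xi>)) \<sigma>1 \<sigma>2)"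

definition local_scaling :: "real \<Rightarrow> real \<Rightarrow> real" where
  "local_scaling \<sigma>1 \<sigma>2 = \<sigma>1 * \<sigma>2"

definition local_skewness :: "real \<Rightarrow> real \<Rightarrow> real" where
  "local_skewness \<sigma>1 \<sigma>2 = (\<sigma>1 / \<sigma>2 + \<sigma>2 / \<sigma>1) / 2"

end

(* The integral identity reads I(theta'(t)) = alpha (1 - cos t), where the integral I of
   m sin from 0 has the nonzero derivative m(theta') sin theta' at theta' = theta'(theta),
   so theta' is differentiable at theta with derivative alpha sin theta / (m sin theta').
   Near xi the map F extends to a differentiable
   function of the ambient variable, and differentiating F along the meridian and the parallel
   through xi shows that J takes the orthonormal coordinate frame at xi to multiples of the one
   at F(xi), by factors d theta'/d theta and sin theta' / sin theta. This is one singular value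
   decomposition of J. Any other one yields the same product and sum of squares of singular
   values, and s and Q are functions of those two quantities. *)

theory Submission
  imports Defs
begin

section \<open>Real analysis: integrability and implicit differentiation\<close>

text \<open>The finite exceptional set is negligible, so deleting it does not affect integrability.
  On the rest \<open>f\<close> is continuous, hence Lebesgue measurable, and it is dominated by a
  constant.\<close>

lemma bounded_piecewise_continuous_integrable:
  fixes f :: "real \<Rightarrow> real"
  assumes fin: "finite {t \<in> {a..b}. \<not> continuous (at t within {a..b}) f}"
    and bound: "\<And>t. t \<in> {a..b} \<Longrightarrow> \<bar>f t\<bar> \<le> C"
  shows "f integrable_on {a..b}"
proof -
  define D where "D = {t \<in> {a..b}. \<not> continuous (at t within {a..b}) f}"
  have neg: "negligible D" using fin by (simp add: D_def negligible_finite)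
  have S: "{a..b} - D \<in> sets lebesgue"
    using negligible_imp_sets[OF neg] by (intro sets.Diff) auto
  have spike: "g integrable_on ({a..b} - D) \<longleftrightarrow> g integrable_on {a..b}" for g :: "real \<Rightarrow> real"
    by (intro integrable_spike_set_eq negligible_subset[OF neg]) auto
  have "continuous_on ({a..b} - D) f"
    unfolding continuous_on_eq_continuous_within
    by (auto simp: D_def intro: continuous_within_subset)
  then have "f \<in> borel_measurable (lebesgue_on ({a..b} - D))"
    using S by (rule continuous_imp_measurable_on_sets_lebesgue)
  moreover have "(\<lambda>_. C) integrable_on ({a..b} - D)"
    by (simp add: spike integrable_const_ivl)
  ultimately have "f integrable_on ({a..b} - D)"
    by (rule measurable_bounded_by_integrable_imp_integrable[OF _ _ _ S]) (use bound in simp)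
  then show ?thesis
    by (simp add: spike)
qed

text \<open>With the Caratheodory slope \<open>q\<close> of \<open>G\<close> at \<open>T x\<close>,
  the increment of \<open>r\<close> equals \<open>q (T t) * (T t - T x)\<close>. Since
  \<open>q (T t)\<close> tends to \<open>g\<close>, which is nonzero, it can be divided out of the
  difference quotient of \<open>r\<close>, leaving that of \<open>T\<close>.\<close>

lemma DERIV_of_integral_equation:
  fixes G r T :: "real \<Rightarrow> real"
  assumes G: "(G has_real_derivative g) (at (T x))" and "g \<noteq> 0"
    and T: "isCont T x"
    and r: "(r has_real_derivative d) (at x)"
    and eq: "\<forall>\<^sub>F t in at x. G (T t) = r t" "G (T x) = r x"
  shows "(T has_real_derivative d / g) (at x)"
proof -
  obtain q where q: "\<And>z. G z - G (T x) = q z * (z - T x)" "isCont q (T x)" "q (T x) = g"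
    using G unfolding CARAT_DERIV by blast
  have lim: "((\<lambda>t. q (T t)) \<longlongrightarrow> g) (at x)"
    using isCont_o2[OF T q(2)] q(3) by (simp add: isCont_def)
  then have nz: "\<forall>\<^sub>F t in at x. q (T t) \<noteq> 0"
    using \<open>g \<noteq> 0\<close> by (rule tendsto_imp_eventually_ne)
  have "((\<lambda>t. (r t - r x) / (t - x) / q (T t)) \<longlongrightarrow> d / g) (at x)"
    using r lim \<open>g \<noteq> 0\<close> by (intro tendsto_divide) (auto simp: has_field_derivative_iff)
  moreover have "\<forall>\<^sub>F t in at x. (r t - r x) / (t - x) / q (T t) = (T t - T x) / (t - x)"
    using nz eq(1)
  proof eventually_elim
    case (elim t)
    then have "(r t - r x) / q (T t) = T t - T x"
      using q(1)[of "T t"] eq(2) by simp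
    then show ?case by (metis divide_divide_eq_left mult.commute)
  qed
  ultimately show ?thesis
    unfolding has_field_derivative_iff by (rule Lim_transform_eventually)
qed

section \<open>Monitor functions and the equidistributing angle\<close>

lemma monitor_function_pos:
  assumes "monitor_function m" "t \<in> {0..pi}"
  shows "0 < m t"
proof -
  obtain c where "0 < c" "\<forall>t\<in>{0..pi}. c \<le> m t"
    using assms(1) unfolding monitor_function_def by blast
  then show ?thesis using assms(2) by (meson less_le_trans)
qed

lemma monitor_integrable:
  assumes "monitor_function m"
  shows "(\<lambda>t. m t * sin t) integrable_on {0..pi}"
proof -
  obtain c C where C: "0 < c" "\<And>t. t \<in> {0..pi} \<Longrightarrow> c \<le> m t \<and> m t \<le> C"
    using assms unfolding monitor_function_def by blast
  have "finite {t \<in> {0..pi}. \<not> continuous (at t within {0..pi}) m}"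
    using assms by (simp add: monitor_function_def)
  \<comment> \<open>As \<open>sin\<close> is continuous, every discontinuity of the product is one
    of \<open>m\<close>.\<close>
  then have "finite {t \<in> {0..pi}. \<not> continuous (at t within {0..pi}) (\<lambda>t. m t * sin t)}"
    by (rule rev_finite_subset) (auto intro!: continuous_intros)
  moreover have "\<bar>m t * sin t\<bar> \<le> C" if "t \<in> {0..pi}" for t
  proof -
    have "\<bar>m t\<bar> * \<bar>sin t\<bar> \<le> C * 1"
      using C(1) C(2)[OF that] by (intro mult_mono) auto
    then show ?thesis by (simp add: abs_mult)
  qed
  ultimately show ?thesis by (rule bounded_piecewise_continuous_integrable)
qed

text \<open>Comparison with a positive lower bound \<open>c\<close> of \<open>m\<close>: the
  integral of \<open>c * sin t\<close> over \<open>{0..pi}\<close> is \<open>2 * c\<close>.\<close>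

lemma normalisation_constant_pos:
  assumes "monitor_function m"
  shows "0 < normalisation_constant m"
proof -
  obtain c C where C: "0 < c" "\<And>t. t \<in> {0..pi} \<Longrightarrow> c \<le> m t"
    using assms unfolding monitor_function_def by blast
  have sin: "((\<lambda>t. c * sin t) has_integral (- c * cos pi - (- c * cos 0))) {0..pi}"
    by (rule fundamental_theorem_of_calculus)
       (auto intro!: derivative_eq_intros simp: has_real_derivative_iff_has_vector_derivative[symmetric])
  have "- c * cos pi - (- c * cos 0) \<le> integral {0..pi} (\<lambda>t. m t * sin t)"
    using sin integrable_integral[OF monitor_integrable[OF assms]]
    by (rule has_integral_le) (auto intro!: mult_right_mono C(2) sin_ge_zero)
  then show ?thesis using C(1) by (simp add: normalisation_constant_def)
qed

lemma equidistributing_angle_interior: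
  assumes "equidistributing_angle m T" "\<theta> \<in> {0<..<pi}"
  shows "T \<theta> \<in> {0<..<pi}"
proof -
  have mono: "strict_mono_on {0..pi} T" and bij: "bij_betw T {0..pi} {0..pi}"
    using assms(1) by (auto simp: equidistributing_angle_def)
  have "T 0 \<in> {0..pi}" "T pi \<in> {0..pi}"
    using bij_betwE[OF bij] by auto
  moreover have "T 0 < T \<theta>" "T \<theta> < T pi"
    using assms(2) by (auto intro!: strict_mono_onD[OF mono])
  ultimately show ?thesis by auto
qed

lemma DERIV_equidistributing_angle:
  assumes m: "monitor_function m" and T: "equidistributing_angle m T" and \<theta>: "\<theta> \<in> {0<..<pi}"
    and cont: "continuous (at (T \<theta>) within {0..pi}) m"
  shows "(T has_real_derivative normalisation_constant m * sin \<theta> / (m (T \<theta>) * sin (T \<theta>))) (at \<theta>)"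
proof (rule DERIV_of_integral_equation)
  have T\<theta>: "T \<theta> \<in> {0<..<pi}" using equidistributing_angle_interior[OF T \<theta>] .
  have "continuous (at (T \<theta>) within {0..pi}) (\<lambda>t. m t * sin t)"
    using cont by (intro continuous_intros)
  then show "((\<lambda>u. integral {0..u} (\<lambda>t. m t * sin t)) has_real_derivative m (T \<theta>) * sin (T \<theta>)) (at (T \<theta>))"
    \<comment> \<open>The fundamental theorem gives the derivative within \<open>{0..pi}\<close>; it
      is two-sided because \<open>T \<theta>\<close> is an interior point.\<close>
    using integral_has_vector_derivative_continuous_at[OF monitor_integrable[OF m], of "T \<theta>" "{}"] T\<theta>
    by (simp add: has_real_derivative_iff_has_vector_derivative at_within_Icc_at)
  show "m (T \<theta>) * sin (T \<theta>) \<noteq> 0"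
    using monitor_function_pos[OF m, of "T \<theta>"] T\<theta> sin_gt_zero[of "T \<theta>"] by auto
  show "isCont T \<theta>"
    using T \<theta> unfolding equidistributing_angle_def
    by (auto intro!: continuous_on_interior[of "{0..pi}"])
  show "((\<lambda>t. normalisation_constant m * (1 - cos t)) has_real_derivative normalisation_constant m * sin \<theta>) (at \<theta>)"
    by (auto intro!: derivative_eq_intros)
  have eq: "integral {0..T t} (\<lambda>t. m t * sin t) = normalisation_constant m * (1 - cos t)"
    if "t \<in> {0<..<pi}" for t
    using T that unfolding equidistributing_angle_def by simp
  \<comment> \<open>The integral identity is available only for angles in \<open>{0..pi}\<close>,
    but this includes a neighbourhood of \<open>\<theta>\<close>.\<close>
  have "\<forall>\<^sub>F t in at \<theta>. t \<in> {0<..<pi}"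
    using \<theta> by (intro eventually_at_in_open') auto
  then show "\<forall>\<^sub>F t in at \<theta>. integral {0..T t} (\<lambda>t. m t * sin t) = normalisation_constant m * (1 - cos t)"
    by eventually_elim (rule eq)
  show "integral {0..T \<theta>} (\<lambda>t. m t * sin t) = normalisation_constant m * (1 - cos \<theta>)"
    using \<theta> by (rule eq)
qed

section \<open>Orthonormal frames and uniqueness of singular values\<close>

text \<open>Nonzero pairwise orthogonal vectors are independent, and three independent vectors span
  \<open>real ^ 3\<close>.\<close>

lemma orthonormal_frame_expansion:
  assumes "orthonormal_frame a b c"
  shows "x = (x \<bullet> a) *\<^sub>R a + (x \<bullet> b) *\<^sub>R b + (x \<bullet> c) *\<^sub>R c"
proof -
  note fr = assms[unfolded orthonormal_frame_def]
  have ne: "a \<noteq> b" "a \<noteq> c" "b \<noteq> c"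
    using fr by (auto simp: norm_eq_1)
  have po: "pairwise orthogonal {a, b, c}"
    using fr by (auto simp: pairwise_def orthogonal_def inner_commute)
  then have "independent {a, b, c}"
    using fr by (intro pairwise_orthogonal_independent) auto
  then have "UNIV \<subseteq> span {a, b, c}"
    using ne by (intro card_ge_dim_independent) auto
  then show ?thesis
    using orthonormal_basis_expand[OF po, of x] ne fr by (simp add: add.assoc subset_iff) metis
qed

lemma orthonormal_basis_pair_tangent_plane:
  assumes "orthonormal_frame a b \<xi>"
  shows "orthonormal_basis_pair (tangent_plane \<xi>) a b"
proof -
  note fr = assms[unfolded orthonormal_frame_def]
  have "span {a, b} = tangent_plane \<xi>"
  proof
    show "span {a, b} \<subseteq> tangent_plane \<xi>"
      using fr by (auto simp: span_insert span_empty tangent_plane_def algebra_simps)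
    show "tangent_plane \<xi> \<subseteq> span {a, b}"
    proof
      fix v assume "v \<in> tangent_plane \<xi>"
      then have "v = (v \<bullet> a) *\<^sub>R a + (v \<bullet> b) *\<^sub>R b"
        using orthonormal_frame_expansion[OF assms, of v] by (simp add: tangent_plane_def)
      then show "v \<in> span {a, b}"
        by (metis insertI1 insertI2 span_add span_base span_scale)
    qed
  qed
  then show ?thesis using fr by (simp add: orthonormal_basis_pair_def)
qed

lemma orthonormal_basis_pair_obtain_coordinates:
  assumes "orthonormal_basis_pair U u1 u2" "x \<in> U"
  obtains a b where "x = a *\<^sub>R u1 + b *\<^sub>R u2"
  using assms by (auto simp: orthonormal_basis_pair_def span_insert algebra_simps)

text \<open>The two invariants are the absolute determinant and the squared Frobenius norm of \<open>J\<close>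
  on \<open>U\<close>.\<close>

lemma singular_value_pair_invariants:
  assumes J: "linear J" and "singular_value_pair J U V \<sigma>1 \<sigma>2" and "singular_value_pair J U V s1 s2"
  shows "\<sigma>1 * \<sigma>2 = s1 * s2" "\<sigma>1\<^sup>2 + \<sigma>2\<^sup>2 = s1\<^sup>2 + s2\<^sup>2"
proof -
  obtain a1 a2 b1 b2 where a: "orthonormal_basis_pair U a1 a2" and b: "orthonormal_basis_pair V b1 b2"
    and Ja: "J a1 = \<sigma>1 *\<^sub>R b1" "J a2 = \<sigma>2 *\<^sub>R b2" and \<sigma>: "0 \<le> \<sigma>1" "0 \<le> \<sigma>2"
    using assms(2) unfolding singular_value_pair_def by blast
  obtain u1 u2 v1 v2 where u: "orthonormal_basis_pair U u1 u2" and v: "orthonormal_basis_pair V v1 v2"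
    and Ju: "J u1 = s1 *\<^sub>R v1" "J u2 = s2 *\<^sub>R v2" and s: "0 \<le> s1" "0 \<le> s2"
    using assms(3) unfolding singular_value_pair_def by blast
  have inU: "a1 \<in> U" "a2 \<in> U"
    using a by (auto simp: orthonormal_basis_pair_def intro: span_base)
  obtain p q where a1: "a1 = p *\<^sub>R u1 + q *\<^sub>R u2"
    using orthonormal_basis_pair_obtain_coordinates[OF u inU(1)] .
  obtain r t where a2: "a2 = r *\<^sub>R u1 + t *\<^sub>R u2"
    using orthonormal_basis_pair_obtain_coordinates[OF u inU(2)] .
  have on: "a1 \<bullet> a1 = 1" "a2 \<bullet> a2 = 1" "a1 \<bullet> a2 = 0" "u1 \<bullet> u1 = 1" "u2 \<bullet> u2 = 1" "u1 \<bullet> u2 = 0"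
     "v1 \<bullet> v1 = 1" "v2 \<bullet> v2 = 1" "v1 \<bullet> v2 = 0" "b1 \<bullet> b1 = 1" "b2 \<bullet> b2 = 1" "b1 \<bullet> b2 = 0"
    using a b u v by (auto simp: orthonormal_basis_pair_def norm_eq_1)
  \<comment> \<open>The change of basis between the two orthonormal bases of \<open>U\<close> is an
    orthogonal matrix with rows \<open>(p, q)\<close> and \<open>(r, t)\<close>.\<close>
  have pq: "p\<^sup>2 + q\<^sup>2 = 1" "r\<^sup>2 + t\<^sup>2 = 1" "p * r + q * t = 0"
    using on(1-3) unfolding a1 a2
    by (simp_all add: inner_add_left inner_add_right on inner_commute[of u2 u1] power2_eq_square mult.commute)
  have J1: "\<sigma>1 *\<^sub>R b1 = (p * s1) *\<^sub>R v1 + (q * s2) *\<^sub>R v2"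
    unfolding Ja[symmetric] a1 by (simp add: linear_add[OF J] linear_cmul[OF J] Ju)
  have J2: "\<sigma>2 *\<^sub>R b2 = (r * s1) *\<^sub>R v1 + (t * s2) *\<^sub>R v2"
    unfolding Ja[symmetric] a2 by (simp add: linear_add[OF J] linear_cmul[OF J] Ju)
  \<comment> \<open>\<open>n1\<close>, \<open>n2\<close> and \<open>n12\<close> are the entries of
    the Gram matrix of \<open>J a1\<close> and \<open>J a2\<close>, computed in both pairs of
    bases.\<close>
  have n1: "\<sigma>1\<^sup>2 = p\<^sup>2 * s1\<^sup>2 + q\<^sup>2 * s2\<^sup>2"
    using arg_cong[OF J1, of "\<lambda>x. x \<bullet> x"]
    by (simp add: inner_add_left inner_add_right on inner_commute[of v2 v1] power2_eq_square mult_ac)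
  have n2: "\<sigma>2\<^sup>2 = r\<^sup>2 * s1\<^sup>2 + t\<^sup>2 * s2\<^sup>2"
    using arg_cong[OF J2, of "\<lambda>x. x \<bullet> x"]
    by (simp add: inner_add_left inner_add_right on inner_commute[of v2 v1] power2_eq_square mult_ac)
  have n12: "p * r * s1\<^sup>2 + q * t * s2\<^sup>2 = 0"
    using arg_cong2[OF J1 J2, of "(\<bullet>)"]
    by (simp add: inner_add_left inner_add_right on inner_commute[of v2 v1] power2_eq_square mult_ac)
  have det: "(p * t - q * r)\<^sup>2 = 1"
    using pq by algebra
  have rows: "p\<^sup>2 = t\<^sup>2" "q\<^sup>2 = r\<^sup>2"
    using pq by algebra+
  \<comment> \<open>This is the trace of the Gram matrix; by \<open>rows\<close> the columns of the
    orthogonal matrix have unit length too.\<close>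
  show "\<sigma>1\<^sup>2 + \<sigma>2\<^sup>2 = s1\<^sup>2 + s2\<^sup>2"
    using n1 n2 rows pq by algebra
  \<comment> \<open>The Gram determinant \<open>n1 * n2 - n12^2\<close> equals
    \<open>(p * t - q * r)^2 * s1^2 * s2^2\<close>.\<close>
  have "(\<sigma>1 * \<sigma>2)\<^sup>2 = (s1 * s2)\<^sup>2"
    using n1 n2 n12 det by algebra
  then show "\<sigma>1 * \<sigma>2 = s1 * s2"
    by (rule power2_eq_imp_eq) (use \<sigma> s in auto)
qed

section \<open>Spherical coordinates and their moving frame\<close>

definition meridian_tangent ::
    "real ^ 3 \<Rightarrow> real ^ 3 \<Rightarrow> real ^ 3 \<Rightarrow> real \<Rightarrow> real \<Rightarrow> real ^ 3" where
  "meridian_tangent e1 e2 \<omega> \<theta> \<phi> =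
     (cos \<theta> * cos \<phi>) *\<^sub>R e1 + (cos \<theta> * sin \<phi>) *\<^sub>R e2 - sin \<theta> *\<^sub>R \<omega>"

text \<open>The derivative of \<open>spherical_point\<close> in \<open>\<phi>\<close> has length
  \<open>sin \<theta>\<close> for angles in \<open>{0..pi}\<close>. Dividing by
  \<open>sin \<theta>\<close> leaves this unit vector, which is the same at \<xi> and at its image
  under the map.\<close>

definition parallel_tangent :: "real ^ 3 \<Rightarrow> real ^ 3 \<Rightarrow> real \<Rightarrow> real ^ 3" where
  "parallel_tangent e1 e2 \<phi> = - sin \<phi> *\<^sub>R e1 + cos \<phi> *\<^sub>R e2"

text \<open>The third vector is the position vector, so the first two form an orthonormal basis of
  the tangent plane there.\<close>

lemma orthonormal_frame_spherical:
  assumes "orthonormal_frame e1 e2 \<omega>"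
  shows "orthonormal_frame (meridian_tangent e1 e2 \<omega> \<theta> \<phi>) (parallel_tangent e1 e2 \<phi>)
           (spherical_point e1 e2 \<omega> \<theta> \<phi>)"
proof -
  have on: "e1 \<bullet> e1 = 1" "e2 \<bullet> e2 = 1" "\<omega> \<bullet> \<omega> = 1" "e1 \<bullet> e2 = 0" "e1 \<bullet> \<omega> = 0" "e2 \<bullet> \<omega> = 0"
    "e2 \<bullet> e1 = 0" "\<omega> \<bullet> e1 = 0" "\<omega> \<bullet> e2 = 0"
    using assms by (auto simp: orthonormal_frame_def norm_eq_1 inner_commute)
  \<comment> \<open>Covers the contribution of the \<open>e1\<close> and \<open>e2\<close>
    components to each inner product of meridian and position vectors.\<close>
  have pyth: "u * cos \<phi> * (v * cos \<phi>) + u * sin \<phi> * (v * sin \<phi>) = u * v" for u v :: real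
  proof -
    have "u * cos \<phi> * (v * cos \<phi>) + u * sin \<phi> * (v * sin \<phi>) = u * v * ((sin \<phi>)\<^sup>2 + (cos \<phi>)\<^sup>2)"
      by algebra
    then show ?thesis by simp
  qed
  show ?thesis
    unfolding orthonormal_frame_def norm_eq_1 meridian_tangent_def parallel_tangent_def spherical_point_def
    by (simp add: inner_add_left inner_add_right inner_diff_left inner_diff_right on pyth)
       (simp add: power2_eq_square[symmetric])
qed

lemma spherical_point_in_unit_sphere:
  assumes "orthonormal_frame e1 e2 \<omega>"
  shows "spherical_point e1 e2 \<omega> \<theta> \<phi> \<in> unit_sphere"
  using orthonormal_frame_spherical[OF assms] by (auto simp: orthonormal_frame_def)

lemma spherical_point_inner_axis:
  assumes "orthonormal_frame e1 e2 \<omega>"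
  shows "spherical_point e1 e2 \<omega> \<theta> \<phi> \<bullet> \<omega> = cos \<theta>"
  using assms by (simp add: orthonormal_frame_def norm_eq_1 spherical_point_def inner_add_left)

lemma has_vector_derivative_spherical_point_meridian:
  "((\<lambda>t. spherical_point e1 e2 \<omega> t \<phi>) has_vector_derivative meridian_tangent e1 e2 \<omega> \<theta> \<phi>) (at \<theta>)"
  unfolding spherical_point_def meridian_tangent_def
  by (auto intro!: derivative_eq_intros simp: has_vector_derivative_def algebra_simps)

lemma has_vector_derivative_spherical_point_parallel:
  "((\<lambda>t. spherical_point e1 e2 \<omega> \<theta> t) has_vector_derivative sin \<theta> *\<^sub>R parallel_tangent e1 e2 \<phi>) (at \<phi>)"
  unfolding spherical_point_def parallel_tangent_def
  by (auto intro!: derivative_eq_intros simp: has_vector_derivative_def algebra_simps)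

text \<open>The component of \<open>x\<close> orthogonal to \<open>\<omega>\<close> has length
  \<open>sin (arccos (x \<bullet> \<omega>))\<close>; \<open>\<phi>\<close> is its polar angle in
  the plane of \<open>e1\<close> and \<open>e2\<close>.\<close>

lemma unit_sphere_spherical_point:
  assumes fr: "orthonormal_frame e1 e2 \<omega>" and x: "x \<in> unit_sphere"
  obtains \<phi> where "x = spherical_point e1 e2 \<omega> (arccos (x \<bullet> \<omega>)) \<phi>"
proof -
  define a b z where "a = x \<bullet> e1" and "b = x \<bullet> e2" and "z = x \<bullet> \<omega>"
  have x_eq: "x = a *\<^sub>R e1 + b *\<^sub>R e2 + z *\<^sub>R \<omega>"
    unfolding a_def b_def z_def by (rule orthonormal_frame_expansion[OF fr])
  have "x \<bullet> x = a\<^sup>2 + b\<^sup>2 + z\<^sup>2"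
    by (subst (2) x_eq) (simp add: inner_add_right a_def b_def z_def power2_eq_square)
  then have sum: "a\<^sup>2 + b\<^sup>2 = 1 - z\<^sup>2"
    using x by (simp add: norm_eq_1)
  then have "z\<^sup>2 \<le> 1"
    using sum_power2_ge_zero[of a b] by linarith
  then have z: "-1 \<le> z" "z \<le> 1"
    unfolding abs_square_le_1 by linarith+
  define s where "s = sin (arccos z)"
  have s: "s\<^sup>2 = a\<^sup>2 + b\<^sup>2"
    using sum z by (simp add: s_def sin_squared_eq)
  have "\<exists>\<phi>. a = s * cos \<phi> \<and> b = s * sin \<phi>"
  \<comment> \<open>At the poles \<open>a\<close> and \<open>b\<close> vanish, and any
    \<open>\<phi>\<close> serves.\<close>
  proof (cases "s = 0")
    case True
    then show ?thesis using s by (simp add: sum_power2_eq_zero_iff)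
  next
    case False
    then have "(a / s)\<^sup>2 + (b / s)\<^sup>2 = 1"
      by (simp add: power_divide add_divide_distrib[symmetric] s[symmetric])
    then obtain t where "a / s = cos t" "b / s = sin t"
      by (rule sincos_total_2pi)
    then show ?thesis using False by (auto simp: field_simps)
  qed
  then obtain \<phi> where "a = s * cos \<phi>" "b = s * sin \<phi>" by blast
  then have "x = spherical_point e1 e2 \<omega> (arccos z) \<phi>"
    using x_eq z by (simp add: spherical_point_def s_def)
  then show ?thesis unfolding z_def by (rule that)
qed

section \<open>The differential of the axisymmetric map\<close>

text \<open>As \<open>F\<close> keeps \<open>\<phi>\<close>, it only rescales the part of
  \<open>x\<close> orthogonal to \<open>\<omega>\<close>, by \<open>sin (T t) / sin t\<close>, and
  makes the axial coordinate \<open>cos (T t)\<close>, where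
  \<open>t = arccos (x \<bullet> \<omega>)\<close>. Away from the poles this formula is
  differentiable wherever \<open>T\<close> is differentiable at \<open>t\<close>.\<close>

lemma axisymmetric_map_differentiable:
  assumes fr: "orthonormal_frame e1 e2 \<omega>" and F: "axisymmetric_map e1 e2 \<omega> T F"
    and \<theta>: "\<theta> \<in> {0<..<pi}" and T: "(T has_real_derivative d) (at \<theta>)"
  shows "F differentiable (at (spherical_point e1 e2 \<omega> \<theta> \<phi>) within unit_sphere)"
proof -
  define \<xi> where "\<xi> = spherical_point e1 e2 \<omega> \<theta> \<phi>"
  have \<omega>: "norm \<omega> = 1" using fr by (simp add: orthonormal_frame_def)
  have \<xi>\<omega>: "\<xi> \<bullet> \<omega> = cos \<theta>"
    unfolding \<xi>_def by (rule spherical_point_inner_axis[OF fr])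
  have sin: "0 < sin \<theta>" and cos: "-1 < cos \<theta>" "cos \<theta> < 1"
    using \<theta> sin_gt_zero[of \<theta>] cos_monotone_0_pi[of 0 \<theta>] cos_monotone_0_pi[of \<theta> pi] by auto
  have ac: "arccos (\<xi> \<bullet> \<omega>) = \<theta>"
    using \<theta> by (simp add: \<xi>\<omega> arccos_cos)
  define a where "a t = sin (T t) / sin t" for t
  txt \<open>\<open>G\<close> extends \<open>F\<close> to a neighbourhood of \<open>\<xi>\<close> in the ambient space, without mentioning \<open>\<phi>\<close>.\<close>
  define G where "G x = a (arccos (x \<bullet> \<omega>)) *\<^sub>R (x - (x \<bullet> \<omega>) *\<^sub>R \<omega>)
      + cos (T (arccos (x \<bullet> \<omega>))) *\<^sub>R \<omega>" for x
  have "(\<lambda>x. arccos (x \<bullet> \<omega>)) differentiable (at \<xi>)"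
    using cos unfolding differentiable_def
    by (intro exI) (rule DERIV_compose_FDERIV[OF DERIV_arccos] | auto intro!: derivative_intros simp: \<xi>\<omega>)+
  moreover have "(\<lambda>t. cos (T t)) differentiable (at \<theta>)" "a differentiable (at \<theta>)"
    using T sin unfolding a_def
    by (auto intro!: derivative_eq_intros exI simp: real_differentiable_def)
  ultimately have "(\<lambda>x. a (arccos (x \<bullet> \<omega>))) differentiable (at \<xi>)"
      "(\<lambda>x. cos (T (arccos (x \<bullet> \<omega>)))) differentiable (at \<xi>)"
    by (auto simp: ac intro: differentiable_compose)
  then have "G differentiable (at \<xi>)"
    unfolding G_def by (intro derivative_intros) auto
  then have G: "G differentiable (at \<xi> within unit_sphere)"
    by (rule differentiable_at_withinI)
  have \<xi>: "\<xi> \<in> unit_sphere"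
    unfolding \<xi>_def by (rule spherical_point_in_unit_sphere[OF fr])
  \<comment> \<open>The axial coordinate differs from \<open>cos \<theta>\<close> by at most
    \<open>dist x \<xi>\<close>, so this radius keeps \<open>x\<close> away from the poles, where
    \<open>sin t\<close> would vanish.\<close>
  have GF: "G x = F x" if x: "x \<in> unit_sphere" "dist x \<xi> < 1 - \<bar>cos \<theta>\<bar>" for x
  proof -
    obtain \<psi> where \<psi>: "x = spherical_point e1 e2 \<omega> (arccos (x \<bullet> \<omega>)) \<psi>"
      using unit_sphere_spherical_point[OF fr x(1)] .
    define t where "t = arccos (x \<bullet> \<omega>)"
    have x_eq: "x = spherical_point e1 e2 \<omega> t \<psi>"
      unfolding t_def by (rule \<psi>)
    have "\<bar>(x - \<xi>) \<bullet> \<omega>\<bar> \<le> dist x \<xi>"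
      using Cauchy_Schwarz_ineq2[of "x - \<xi>" \<omega>] \<omega> by (simp add: dist_norm)
    then have "\<bar>x \<bullet> \<omega>\<bar> < 1"
      using x(2) by (simp add: inner_diff_left \<xi>\<omega>)
    then have t: "t \<in> {0<..<pi}"
      using arccos_lt_bounded[of "x \<bullet> \<omega>"] by (auto simp: t_def)
    have xw: "x \<bullet> \<omega> = cos t"
      unfolding x_eq by (rule spherical_point_inner_axis[OF fr])
    have "sin t \<noteq> 0" using t sin_gt_zero[of t] by auto
    have "x - (x \<bullet> \<omega>) *\<^sub>R \<omega> = sin t *\<^sub>R (cos \<psi> *\<^sub>R e1 + sin \<psi> *\<^sub>R e2)"
      unfolding xw by (subst x_eq) (simp add: spherical_point_def algebra_simps)
    then have "G x = spherical_point e1 e2 \<omega> (T t) \<psi>"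
      using \<open>sin t \<noteq> 0\<close>
      by (simp add: G_def t_def[symmetric] a_def spherical_point_def scaleR_add_right)
    also have "\<dots> = F x"
      using F t by (subst x_eq) (simp add: axisymmetric_map_def)
    finally show ?thesis .
  qed
  have "0 < 1 - \<bar>cos \<theta>\<bar>" using cos by auto
  from differentiable_transform_within[OF G this \<xi> GF] show ?thesis
    unfolding \<xi>_def .
qed

text \<open>Differentiating \<open>F\<close> along meridians and parallels gives \<open>J\<close> on a tangent basis,
  whichever ambient extension of the differential \<open>J\<close> is.\<close>

lemma axisymmetric_map_derivative_tangent:
  assumes fr: "orthonormal_frame e1 e2 \<omega>" and F: "axisymmetric_map e1 e2 \<omega> T F"
    and \<theta>: "\<theta> \<in> {0<..<pi}" and T: "(T has_real_derivative d) (at \<theta>)"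
    and J: "(F has_derivative J) (at (spherical_point e1 e2 \<omega> \<theta> \<phi>) within unit_sphere)"
  shows "J (meridian_tangent e1 e2 \<omega> \<theta> \<phi>) = d *\<^sub>R meridian_tangent e1 e2 \<omega> (T \<theta>) \<phi>"
    and "J (parallel_tangent e1 e2 \<phi>) = (sin (T \<theta>) / sin \<theta>) *\<^sub>R parallel_tangent e1 e2 \<phi>"
proof -
  let ?P = "spherical_point e1 e2 \<omega>"
  have F_eq: "F (?P t \<psi>) = ?P (T t) \<psi>" if "t \<in> {0<..<pi}" for t \<psi>
    using F that by (simp add: axisymmetric_map_def)
  \<comment> \<open>A derivative within the sphere is also one within the image of any curve on it,
    which is the form the chain rule asks for.\<close>
  have J_subset: "(F has_derivative J) (at (?P \<theta> \<phi>) within range c)"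
    if "range c \<subseteq> unit_sphere" for c :: "real \<Rightarrow> _"
    using J that by (rule has_derivative_subset)
  have "((F \<circ> (\<lambda>t. ?P t \<phi>)) has_vector_derivative J (meridian_tangent e1 e2 \<omega> \<theta> \<phi>)) (at \<theta>)"
    using spherical_point_in_unit_sphere[OF fr]
    by (intro vector_derivative_diff_chain_within[OF has_vector_derivative_spherical_point_meridian] J_subset) auto
  then have "((\<lambda>t. ?P (T t) \<phi>) has_vector_derivative J (meridian_tangent e1 e2 \<omega> \<theta> \<phi>)) (at \<theta>)"
    by (rule has_vector_derivative_transform_within_open[of _ _ _ "{0<..<pi}"]) (use \<theta> F_eq in auto)
  \<comment> \<open>The image of the meridian under \<open>F\<close> is the same meridian
    reparametrised by \<open>T\<close>, so its velocity can also be computed directly.\<close>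
  moreover have "((\<lambda>t. ?P (T t) \<phi>) has_vector_derivative d *\<^sub>R meridian_tangent e1 e2 \<omega> (T \<theta>) \<phi>) (at \<theta>)"
    using vector_diff_chain_at[of T d \<theta>, OF _ has_vector_derivative_spherical_point_meridian] T
    by (simp add: o_def has_real_derivative_iff_has_vector_derivative)
  ultimately show "J (meridian_tangent e1 e2 \<omega> \<theta> \<phi>) = d *\<^sub>R meridian_tangent e1 e2 \<omega> (T \<theta>) \<phi>"
    by (rule vector_derivative_unique_at)
  have "((F \<circ> ?P \<theta>) has_vector_derivative J (sin \<theta> *\<^sub>R parallel_tangent e1 e2 \<phi>)) (at \<phi>)"
    using spherical_point_in_unit_sphere[OF fr]
    by (intro vector_derivative_diff_chain_within[OF has_vector_derivative_spherical_point_parallel] J_subset) auto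
  moreover have "F \<circ> ?P \<theta> = ?P (T \<theta>)"
    using F_eq \<theta> by auto
  ultimately have "J (sin \<theta> *\<^sub>R parallel_tangent e1 e2 \<phi>) = sin (T \<theta>) *\<^sub>R parallel_tangent e1 e2 \<phi>"
    using has_vector_derivative_spherical_point_parallel vector_derivative_unique_at by metis
  moreover have "sin \<theta> \<noteq> 0" using \<theta> sin_gt_zero[of \<theta>] by auto
  ultimately show "J (parallel_tangent e1 e2 \<phi>) = (sin (T \<theta>) / sin \<theta>) *\<^sub>R parallel_tangent e1 e2 \<phi>"
    using linear_cmul[OF has_derivative_linear[OF J]]
    by (metis (no_types, lifting) divide_inverse_commute scaleR_scaleR left_inverse scaleR_one)
qed

text \<open>The moving frames at \<xi> and at \<open>F \<xi>\<close> are the two orthonormal bases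
  of the decomposition; \<open>nonneg\<close> makes the diagonal entries admissible as singular
  values.\<close>

lemma singular_value_pair_axisymmetric:
  assumes fr: "orthonormal_frame e1 e2 \<omega>" and F: "axisymmetric_map e1 e2 \<omega> T F"
    and \<theta>: "\<theta> \<in> {0<..<pi}" and T: "(T has_real_derivative d) (at \<theta>)"
    and J: "(F has_derivative J) (at (spherical_point e1 e2 \<omega> \<theta> \<phi>) within unit_sphere)"
    and nonneg: "0 \<le> d" "0 \<le> sin (T \<theta>)"
  shows "singular_value_pair J (tangent_plane (spherical_point e1 e2 \<omega> \<theta> \<phi>))
           (tangent_plane (F (spherical_point e1 e2 \<omega> \<theta> \<phi>))) d (sin (T \<theta>) / sin \<theta>)"
proof -
  have "F (spherical_point e1 e2 \<omega> \<theta> \<phi>) = spherical_point e1 e2 \<omega> (T \<theta>) \<phi>"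
    using F \<theta> by (simp add: axisymmetric_map_def)
  moreover have "0 < sin \<theta>" using \<theta> sin_gt_zero by auto
  ultimately show ?thesis
    using nonneg axisymmetric_map_derivative_tangent[OF fr F \<theta> T J]
      orthonormal_basis_pair_tangent_plane[OF orthonormal_frame_spherical[OF fr]]
    unfolding singular_value_pair_def by fastforce
qed

section \<open>Scaling and skewness\<close>

text \<open>Expresses the skewness through the product and the sum of squares, which
  \<open>singular_value_pair_invariants\<close> shows to be independent of the
  decomposition.\<close>

lemma local_skewness_eq:
  assumes "\<sigma>1 * \<sigma>2 \<noteq> 0"
  shows "local_skewness \<sigma>1 \<sigma>2 = (\<sigma>1\<^sup>2 + \<sigma>2\<^sup>2) / (2 * (\<sigma>1 * \<sigma>2))"
  using assms by (simp add: local_skewness_def field_simps power2_eq_square)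

theorem lemma1:
  fixes \<omega> e1 e2 \<xi> :: "real ^ 3" and m \<theta>' :: "real \<Rightarrow> real" and \<alpha> \<theta> \<phi> :: real
    and F :: "real ^ 3 \<Rightarrow> real ^ 3"
  assumes "\<omega> \<in> unit_sphere"
    and "orthonormal_frame e1 e2 \<omega>"
    and "monitor_function m"
    and "\<alpha> = normalisation_constant m"
    and "equidistributing_angle m \<theta>'"
    and "axisymmetric_map e1 e2 \<omega> \<theta>' F"
    and "\<theta> \<in> {0<..<pi}"
    and "\<xi> = spherical_point e1 e2 \<omega> \<theta> \<phi>"
    and "continuous (at (\<theta>' \<theta>) within {0..pi}) m"
  shows "F differentiable (at \<xi> within unit_sphere) \<and>
    (\<exists>\<sigma>1 \<sigma>2. sphere_singular_values F \<xi> \<sigma>1 \<sigma>2) \<and>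
    (\<forall>\<sigma>1 \<sigma>2. sphere_singular_values F \<xi> \<sigma>1 \<sigma>2 \<longrightarrow>
       local_scaling \<sigma>1 \<sigma>2 = \<alpha> / m (\<theta>' \<theta>) \<and>
       local_skewness \<sigma>1 \<sigma>2 =
         (\<alpha> / m (\<theta>' \<theta>) * ((sin \<theta>)\<^sup>2 / (sin (\<theta>' \<theta>))\<^sup>2) +
          m (\<theta>' \<theta>) / \<alpha> * ((sin (\<theta>' \<theta>))\<^sup>2 / (sin \<theta>)\<^sup>2)) / 2)"
proof -
  \<comment> \<open>\<open>s1\<close> is the stretch along the meridian, the derivative of
    \<open>\<theta>'\<close>; \<open>s2\<close> is the stretch along the parallel, a ratio of radii
    of circles of latitude.\<close>
  define s1 s2 where "s1 = \<alpha> * sin \<theta> / (m (\<theta>' \<theta>) * sin (\<theta>' \<theta>))" and "s2 = sin (\<theta>' \<theta>) / sin \<theta>"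
  have T: "(\<theta>' has_real_derivative s1) (at \<theta>)"
    unfolding s1_def assms(4) by (rule DERIV_equidistributing_angle[OF assms(3,5,7,9)])
  have \<theta>': "\<theta>' \<theta> \<in> {0<..<pi}"
    by (rule equidistributing_angle_interior[OF assms(5,7)])
  have pos: "0 < \<alpha>" "0 < sin \<theta>" "0 < sin (\<theta>' \<theta>)" "0 < m (\<theta>' \<theta>)"
    using normalisation_constant_pos[OF assms(3)] monitor_function_pos[OF assms(3)] assms(4,7) \<theta>' sin_gt_zero
    by auto
  have diff: "F differentiable (at \<xi> within unit_sphere)"
    unfolding assms(8) by (rule axisymmetric_map_differentiable[OF assms(2,6,7) T])
  \<comment> \<open>Stated for every \<open>J\<close>, since \<open>sphere_singular_values\<close>
    may use any ambient extension of the differential.\<close>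
  have sv: "singular_value_pair J (tangent_plane \<xi>) (tangent_plane (F \<xi>)) s1 s2"
    if "(F has_derivative J) (at \<xi> within unit_sphere)" for J
    using singular_value_pair_axisymmetric[OF assms(2,6,7) T that[unfolded assms(8)]] pos
    by (simp add: s1_def s2_def assms(8))
  have prod: "s1 * s2 = \<alpha> / m (\<theta>' \<theta>)"
    using pos by (simp add: s1_def s2_def)
  have skew: "local_skewness s1 s2 =
      (\<alpha> / m (\<theta>' \<theta>) * ((sin \<theta>)\<^sup>2 / (sin (\<theta>' \<theta>))\<^sup>2) +
          m (\<theta>' \<theta>) / \<alpha> * ((sin (\<theta>' \<theta>))\<^sup>2 / (sin \<theta>)\<^sup>2)) / 2"
    using pos by (simp add: local_skewness_def s1_def s2_def power2_eq_square mult_ac)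
  have "local_scaling \<sigma>1 \<sigma>2 = s1 * s2 \<and> local_skewness \<sigma>1 \<sigma>2 = local_skewness s1 s2"
    if sv': "sphere_singular_values F \<xi> \<sigma>1 \<sigma>2" for \<sigma>1 \<sigma>2
  proof -
    obtain J where J: "(F has_derivative J) (at \<xi> within unit_sphere)"
      and \<sigma>: "singular_value_pair J (tangent_plane \<xi>) (tangent_plane (F \<xi>)) \<sigma>1 \<sigma>2"
      using sv' unfolding sphere_singular_values_def by blast
    note inv = singular_value_pair_invariants[OF has_derivative_linear[OF J] \<sigma> sv[OF J]]
    have "s1 * s2 \<noteq> 0" using prod pos by simp
    then show ?thesis
      using inv by (simp add: local_scaling_def local_skewness_eq)
  qed
  moreover have "\<exists>\<sigma>1 \<sigma>2. sphere_singular_values F \<xi> \<sigma>1 \<sigma>2"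
    using diff sv unfolding differentiable_def sphere_singular_values_def by blast
  ultimately show ?thesis
    using diff prod skew by simp
qed

end
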